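(* Let $(\mathfrak g,\varphi_i,\xi_i,\eta_i)$ be an almost $3$-contact Lie algebra with abelian structure such that $\psi=0$ and $\mathcal Z\neq0$. Then $\mathfrak h$ is an ideal of $\mathfrak g$ with an abelian hypercomplex structure. Moreover, the center of $\mathfrak h$ contains $\mathcal Z$ and $\mathcal Z_i:=\varphi_i\mathcal Z$ for $i=1,2,3$. The adjoint action of $\xi_i$, $i=1,2,3$, is given by $$[\xi_i,\xi_j]=2\delta\xi_k-\mathcal Z_k,\qquad[\xi_i,X]=0,$$ for any even permutation $(i,j,k)$ of $(1,2,3)$ and for any $X\in\mathfrak h$. If $\delta\neq0$ then $\mathfrak g\cong\mathfrak u\times\mathfrak h$, where $\mathfrak u=\operatorname{span}\{2\delta\xi_1-\mathcal Z_1,2\delta\xi_2-\mathcal Z_2,2\delta\xi_3-\mathcal Z_3\}$ is an ideal isomorphic to $\mathfrak{so}(3)$.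
   Context: An almost contact structure on a real Lie algebra $\mathfrak g$ is a triple $(\varphi,\xi,\eta)$, $\varphi\in\mathrm{End}(\mathfrak g)$, $\xi\in\mathfrak g$, $\eta\in\mathfrak g^*$, with $\varphi^2=-I+\eta\otimes\xi$ and $\eta(\xi)=1$. It is abelian if $\mathrm{ad}_\xi\circ\varphi=\varphi\circ\mathrm{ad}_\xi$ and $[\varphi X,\varphi Y]=[X,Y]$ for all $X,Y\in\operatorname{Ker}\eta$. An almost $3$-contact Lie algebra is a real Lie algebra $\mathfrak g$ of dimension $4n+3$ with three almost contact structures $(\varphi_i,\xi_i,\eta_i)$, $i=1,2,3$, such that for every even permutation $(i,j,k)$ of $(1,2,3)$: $\varphi_k=\varphi_i\varphi_j-\eta_j\otimes\xi_i=-\varphi_j\varphi_i+\eta_i\otimes\xi_j$, $\xi_k=\varphi_i\xi_j=-\varphi_j\xi_i$, $\eta_k=\eta_i\circ\varphi_j=-\eta_j\circ\varphi_i$. It is abelian if each $(\varphi_i,\xi_i,\eta_i)$ is abelian. Set $\mathfrak h=\bigcap_i\operatorname{Ker}\eta_i$ and $\mathfrak v=\langle\xi_1,\xi_2,\xi_3\rangle$. For an abelian structure the following are well defined: $\mathcal Z:=\varphi_i([\xi_j,\xi_k])\in\mathfrak h$ and $\delta\in\mathbb R$ with $2\delta=\eta_i([\xi_j,\xi_k])$ (independent of the even permutation $(i,j,k)$ of $(1,2,3)$); and $\psi:=(\mathrm{ad}_{\xi_i}\circ\varphi_i)|_{\mathfrak h}=(\varphi_i\circ\mathrm{ad}_{\xi_i})|_{\mathfrak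 h}:\mathfrak h\to\mathfrak h$ (independent of $i$). An abelian hypercomplex structure on a Lie algebra is a triple $J_1,J_2,J_3$ of endomorphisms with $J_i^2=-I$, $J_1J_2=-J_2J_1=J_3$ and $[J_iX,J_iY]=[X,Y]$ for all $X,Y$ and $i$. *)

theory Defs
  imports "HOL-Analysis.Analysis"
begin

section \<open>Lie algebras on subspaces of a real vector space\<close>

text \<open>
  A Lie algebra is a pair of a carrier subspace \<open>V\<close> and a bracket \<open>br\<close> that is only constrained
  on \<open>V\<close>. This way ideals, which are themselves Lie algebras, need no type of their own.
\<close>

definition lie_algebra_on :: "'a::real_vector set \<Rightarrow> ('a \<Rightarrow> 'a \<Rightarrow> 'a) \<Rightarrow> bool" where
  "lie_algebra_on V br \<longleftrightarrow>
     subspace V \<and>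
     (\<forall>x\<in>V. \<forall>y\<in>V. br x y \<in> V) \<and>
     (\<forall>x\<in>V. \<forall>y\<in>V. \<forall>z\<in>V. br (x + y) z = br x z + br y z) \<and>
     (\<forall>x\<in>V. \<forall>y\<in>V. \<forall>z\<in>V. br x (y + z) = br x y + br x z) \<and>
     (\<forall>c. \<forall>x\<in>V. \<forall>y\<in>V. br (c *\<^sub>R x) y = c *\<^sub>R br x y) \<and>
     (\<forall>c. \<forall>x\<in>V. \<forall>y\<in>V. br x (c *\<^sub>R y) = c *\<^sub>R br x y) \<and>
     (\<forall>x\<in>V. br x x = 0) \<and>
     (\<forall>x\<in>V. \<forall>y\<in>V. \<forall>z\<in>V. br x (br y z) + br y (br z x) + br z (br x y) = 0)"

definition lie_ideal :: "'a::real_vector set \<Rightarrow> ('a \<Rightarrow> 'a \<Rightarrow> 'a) \<Rightarrow> 'a set \<Rightarrow> bool" where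
  "lie_ideal V br I \<longleftrightarrow> subspace I \<and> I \<subseteq> V \<and> (\<forall>x\<in>V. \<forall>y\<in>I. br x y \<in> I)"

definition lie_center :: "'a::real_vector set \<Rightarrow> ('a \<Rightarrow> 'a \<Rightarrow> 'a) \<Rightarrow> 'a set" where
  "lie_center V br = {x \<in> V. \<forall>y\<in>V. br x y = 0}"

definition lie_isomorphic ::
    "'a::real_vector set \<Rightarrow> ('a \<Rightarrow> 'a \<Rightarrow> 'a) \<Rightarrow> 'b::real_vector set \<Rightarrow> ('b \<Rightarrow> 'b \<Rightarrow> 'b) \<Rightarrow> bool" where
  "lie_isomorphic V br W br' \<longleftrightarrow>
     (\<exists>f. bij_betw f V W \<and>
          (\<forall>x\<in>V. \<forall>y\<in>V. f (x + y) = f x + f y) \<and>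
          (\<forall>c. \<forall>x\<in>V. f (c *\<^sub>R x) = c *\<^sub>R f x) \<and>
          (\<forall>x\<in>V. \<forall>y\<in>V. f (br x y) = br' (f x) (f y)))"

definition prod_bracket ::
    "('a \<Rightarrow> 'a \<Rightarrow> 'a) \<Rightarrow> ('b \<Rightarrow> 'b \<Rightarrow> 'b) \<Rightarrow> 'a \<times> 'b \<Rightarrow> 'a \<times> 'b \<Rightarrow> 'a \<times> 'b" where
  "prod_bracket br br' p q = (br (fst p) (fst q), br' (snd p) (snd q))"

definition so3 :: "(real^3^3) set" where
  "so3 = {A. transpose A = - A}"

definition commutator :: "real^'n^'n \<Rightarrow> real^'n^'n \<Rightarrow> real^'n^'n" where
  "commutator A B = A ** B - B ** A"


section \<open>Almost contact and almost 3-contact structures\<close>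

definition almost_contact ::
    "('a::real_vector \<Rightarrow> 'a) \<Rightarrow> 'a \<Rightarrow> ('a \<Rightarrow> real) \<Rightarrow> bool" where
  "almost_contact \<phi> \<xi> \<eta> \<longleftrightarrow>
     linear \<phi> \<and> linear \<eta> \<and> (\<forall>X. \<phi> (\<phi> X) = - X + \<eta> X *\<^sub>R \<xi>) \<and> \<eta> \<xi> = 1"

definition abelian_almost_contact ::
    "('a::real_vector \<Rightarrow> 'a \<Rightarrow> 'a) \<Rightarrow> ('a \<Rightarrow> 'a) \<Rightarrow> 'a \<Rightarrow> ('a \<Rightarrow> real) \<Rightarrow> bool" where
  "abelian_almost_contact br \<phi> \<xi> \<eta> \<longleftrightarrow>
     (\<forall>X. br \<xi> (\<phi> X) = \<phi> (br \<xi> X)) \<and>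
     (\<forall>X Y. \<eta> X = 0 \<longrightarrow> \<eta> Y = 0 \<longrightarrow> br (\<phi> X) (\<phi> Y) = br X Y)"

text \<open>
  The index set \<open>{1, 2, 3}\<close> is the three-element numeral type \<open>3\<close>, where \<open>3 = 0\<close>.
\<close>

definition even_triple :: "3 \<Rightarrow> 3 \<Rightarrow> 3 \<Rightarrow> bool" where
  "even_triple i j k \<longleftrightarrow> (i, j, k) \<in> {(1, 2, 3), (2, 3, 1), (3, 1, 2)}"

text \<open>
  The whole type \<open>'a\<close> is the underlying space of the Lie algebra. As \<open>dim\<close> is \<open>0\<close> on
  infinite-dimensional spaces, the dimension condition entails finite dimension.
\<close>

definition almost_3_contact_lie_algebra ::
    "('a::real_vector \<Rightarrow> 'a \<Rightarrow> 'a) \<Rightarrow> (3 \<Rightarrow> 'a \<Rightarrow> 'a) \<Rightarrow> (3 \<Rightarrow> 'a) \<Rightarrow> (3 \<Rightarrow> 'a \<Rightarrow> real) \<Rightarrow> bool" where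
  "almost_3_contact_lie_algebra br \<phi> \<xi> \<eta> \<longleftrightarrow>
     lie_algebra_on (UNIV :: 'a set) br \<and>
     (\<exists>n. dim (UNIV :: 'a set) = 4 * n + 3) \<and>
     (\<forall>i. almost_contact (\<phi> i) (\<xi> i) (\<eta> i)) \<and>
     (\<forall>i j k. even_triple i j k \<longrightarrow>
        (\<forall>X. \<phi> k X = \<phi> i (\<phi> j X) - \<eta> j X *\<^sub>R \<xi> i) \<and>
        (\<forall>X. \<phi> k X = - \<phi> j (\<phi> i X) + \<eta> i X *\<^sub>R \<xi> j) \<and>
        \<xi> k = \<phi> i (\<xi> j) \<and> \<xi> k = - \<phi> j (\<xi> i) \<and>
        (\<forall>X. \<eta> k X = \<eta> i (\<phi> j X)) \<and> (\<forall>X. \<eta> k X = - \<eta> j (\<phi> i X)))"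

definition abelian_almost_3_contact_lie_algebra ::
    "('a::real_vector \<Rightarrow> 'a \<Rightarrow> 'a) \<Rightarrow> (3 \<Rightarrow> 'a \<Rightarrow> 'a) \<Rightarrow> (3 \<Rightarrow> 'a) \<Rightarrow> (3 \<Rightarrow> 'a \<Rightarrow> real) \<Rightarrow> bool" where
  "abelian_almost_3_contact_lie_algebra br \<phi> \<xi> \<eta> \<longleftrightarrow>
     almost_3_contact_lie_algebra br \<phi> \<xi> \<eta> \<and>
     (\<forall>i. abelian_almost_contact br (\<phi> i) (\<xi> i) (\<eta> i))"

definition horizontal :: "(3 \<Rightarrow> 'a \<Rightarrow> real) \<Rightarrow> 'a set" where
  "horizontal \<eta> = (\<Inter>i. {X. \<eta> i X = 0})"

text \<open>
  For abelian structures the following three notions do not depend on the even permutation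
  \<open>(i, j, k)\<close> used, see the lemmas below; the definitions use \<open>(1, 2, 3)\<close>. Only the values
  of \<open>psi\<close> on the horizontal subspace are meaningful.
\<close>

definition Zvec :: "('a \<Rightarrow> 'a \<Rightarrow> 'a) \<Rightarrow> (3 \<Rightarrow> 'a \<Rightarrow> 'a) \<Rightarrow> (3 \<Rightarrow> 'a) \<Rightarrow> 'a" where
  "Zvec br \<phi> \<xi> = \<phi> 1 (br (\<xi> 2) (\<xi> 3))"

definition delta :: "('a \<Rightarrow> 'a \<Rightarrow> 'a) \<Rightarrow> (3 \<Rightarrow> 'a) \<Rightarrow> (3 \<Rightarrow> 'a \<Rightarrow> real) \<Rightarrow> real" where
  "delta br \<xi> \<eta> = \<eta> 1 (br (\<xi> 2) (\<xi> 3)) / 2"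

definition psi :: "('a \<Rightarrow> 'a \<Rightarrow> 'a) \<Rightarrow> (3 \<Rightarrow> 'a \<Rightarrow> 'a) \<Rightarrow> (3 \<Rightarrow> 'a) \<Rightarrow> 'a \<Rightarrow> 'a" where
  "psi br \<phi> \<xi> X = br (\<xi> 1) (\<phi> 1 X)"

definition abelian_hypercomplex ::
    "'a::real_vector set \<Rightarrow> ('a \<Rightarrow> 'a \<Rightarrow> 'a) \<Rightarrow> (3 \<Rightarrow> 'a \<Rightarrow> 'a) \<Rightarrow> bool" where
  "abelian_hypercomplex V br J \<longleftrightarrow>
     (\<forall>i. (\<forall>X\<in>V. J i X \<in> V) \<and>
          (\<forall>X\<in>V. \<forall>Y\<in>V. J i (X + Y) = J i X + J i Y) \<and>
          (\<forall>c. \<forall>X\<in>V. J i (c *\<^sub>R X) = c *\<^sub>R J i X) \<and>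
          (\<forall>X\<in>V. J i (J i X) = - X) \<and>
          (\<forall>X\<in>V. \<forall>Y\<in>V. br (J i X) (J i Y) = br X Y)) \<and>
     (\<forall>X\<in>V. J 1 (J 2 X) = J 3 X \<and> - J 2 (J 1 X) = J 3 X)"


section \<open>Independence of the even permutation\<close>

context
  fixes br :: "'a::real_vector \<Rightarrow> 'a \<Rightarrow> 'a" and \<phi> \<xi> \<eta>
  assumes A: "abelian_almost_3_contact_lie_algebra br \<phi> \<xi> \<eta>"
begin

lemma br_minus_aux: "br (- X) Y = - br X Y" "br X (- Y) = - br X Y" "br X Y = - br Y X"
proof -
  have L: "lie_algebra_on (UNIV :: 'a set) br"
    using A by (simp add: abelian_almost_3_contact_lie_algebra_def almost_3_contact_lie_algebra_def)
  then have s: "br (c *\<^sub>R X) Y = c *\<^sub>R br X Y" "br X (c *\<^sub>R Y) = c *\<^sub>R br X Y" for c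
    by (simp_all add: lie_algebra_on_def)
  show "br (- X) Y = - br X Y" "br X (- Y) = - br X Y"
    using s[of "-1"] by simp_all
  have "br (X + Y) (X + Y) = br X X + br X Y + (br Y X + br Y Y)" "br (X + Y) (X + Y) = 0"
    "br X X = 0" "br Y Y = 0"
    using L unfolding lie_algebra_on_def by (metis UNIV_I)+
  then have "br X Y + br Y X = 0" by simp
  then show "br X Y = - br Y X"
    by (simp add: eq_neg_iff_add_eq_0)
qed

lemma structure_aux:
  assumes "even_triple i j k"
  shows "\<phi> k X = \<phi> i (\<phi> j X) - \<eta> j X *\<^sub>R \<xi> i" "\<phi> k X = - \<phi> j (\<phi> i X) + \<eta> i X *\<^sub>R \<xi> j"
    "\<phi> i (\<xi> j) = \<xi> k" "\<phi> j (\<xi> i) = - \<xi> k" "\<eta> i (\<phi> j X) = \<eta> k X" "\<eta> j (\<phi> i X) = - \<eta> k X"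
  using A assms
  unfolding abelian_almost_3_contact_lie_algebra_def almost_3_contact_lie_algebra_def
  by (blast, blast, metis, metis add.inverse_inverse, metis, metis add.inverse_inverse)

lemma abelian_aux:
  "br (\<xi> i) (\<phi> i X) = \<phi> i (br (\<xi> i) X)"
  "\<eta> i X = 0 \<Longrightarrow> \<eta> i Y = 0 \<Longrightarrow> br (\<phi> i X) (\<phi> i Y) = br X Y"
  using A
  unfolding abelian_almost_3_contact_lie_algebra_def abelian_almost_contact_def by blast+

lemma contact_aux:
  "\<phi> i (\<phi> i X) = - X + \<eta> i X *\<^sub>R \<xi> i" "\<eta> i (\<xi> i) = 1" "linear (\<phi> i)" "linear (\<eta> i)"
  using A
  unfolding abelian_almost_3_contact_lie_algebra_def almost_3_contact_lie_algebra_def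
    almost_contact_def by blast+

lemma even_triple_rotate: "even_triple i j k \<Longrightarrow> even_triple j k i"
  by (auto simp: even_triple_def)

lemma phi_xi_aux: "\<phi> i (\<xi> i) = 0"
proof -
  define v where "v = \<phi> i (\<xi> i)"
  have 1: "\<phi> i v = 0"
    using contact_aux(1)[of i "\<xi> i"] contact_aux(2)[of i] by (simp add: v_def)
  then have v: "v = \<eta> i v *\<^sub>R \<xi> i"
    using contact_aux(1)[of i v] contact_aux(3)[of i] by (simp add: linear_0)
  have "\<phi> i v = \<eta> i v *\<^sub>R v"
    using contact_aux(3)[of i] by (subst v) (simp add: linear_cmul v_def)
  then have "\<eta> i v *\<^sub>R v = 0" using 1 by simp
  then show ?thesis using v by (auto simp: v_def)
qed

lemma eta_phi_aux: "\<eta> i (\<phi> i X) = 0"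
proof -
  have "\<phi> i (\<phi> i (\<phi> i X)) = - \<phi> i X"
    using contact_aux(3)[of i]
    by (simp add: contact_aux(1)[of i X] linear_diff linear_neg linear_cmul phi_xi_aux)
  then have "\<eta> i (\<phi> i X) *\<^sub>R \<xi> i = 0"
    using contact_aux(1)[of i "\<phi> i X"] by simp
  moreover have "\<xi> i \<noteq> 0"
    using contact_aux(2)[of i] contact_aux(4)[of i] linear_0 by force
  ultimately show ?thesis by simp
qed

lemma bracket_xi_aux:
  assumes e: "even_triple i j k"
  shows "\<phi> j (br (\<xi> i) (\<xi> j)) = br (\<xi> j) (\<xi> k)" "\<eta> j (br (\<xi> i) (\<xi> j)) = 0"
proof -
  have "\<phi> j (br (\<xi> i) (\<xi> j)) = - \<phi> j (br (\<xi> j) (\<xi> i))"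
    using contact_aux(3)[of j] br_minus_aux(3)[of "\<xi> i" "\<xi> j"] by (simp add: linear_neg)
  also have "\<dots> = br (\<xi> j) (\<xi> k)"
    using structure_aux(4)[OF e]
    by (simp add: abelian_aux(1)[symmetric] br_minus_aux(2))
  finally show "\<phi> j (br (\<xi> i) (\<xi> j)) = br (\<xi> j) (\<xi> k)" .
  have "br (\<xi> i) (\<xi> j) = - \<phi> j (br (\<xi> j) (\<xi> k))"
    using structure_aux(3)[OF even_triple_rotate[OF e]] br_minus_aux(3)[of "\<xi> i" "\<xi> j"]
    by (simp add: abelian_aux(1)[symmetric])
  then show "\<eta> j (br (\<xi> i) (\<xi> j)) = 0"
    using contact_aux(4)[of j] by (simp add: linear_neg eta_phi_aux)
qed

lemma bracket_xi_rotate: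
  assumes e: "even_triple i j k"
  shows "\<phi> i (br (\<xi> j) (\<xi> k)) = \<phi> k (br (\<xi> i) (\<xi> j))"
    "\<eta> i (br (\<xi> j) (\<xi> k)) = \<eta> k (br (\<xi> i) (\<xi> j))"
  using structure_aux(1,5)[OF e, of "br (\<xi> i) (\<xi> j)"] bracket_xi_aux[OF e] by simp_all

lemma even_triple_cases:
  assumes "even_triple i j k"
  shows "i = 1 \<and> j = 2 \<and> k = 3 \<or> i = 2 \<and> j = 3 \<and> k = 1 \<or> i = 3 \<and> j = 1 \<and> k = 2"
  using assms by (simp add: even_triple_def)

lemma Zvec_eq: "even_triple i j k \<Longrightarrow> \<phi> i (br (\<xi> j) (\<xi> k)) = Zvec br \<phi> \<xi>"
  and delta_eq: "even_triple i j k \<Longrightarrow> \<eta> i (br (\<xi> j) (\<xi> k)) = 2 * delta br \<xi> \<eta>"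
  using bracket_xi_rotate[of 1 2 3] bracket_xi_rotate[of 3 1 2]
  by (auto dest!: even_triple_cases simp: Zvec_def delta_def)
    (simp_all add: even_triple_def)

lemma Zvec_horizontal: "Zvec br \<phi> \<xi> \<in> horizontal \<eta>"
proof -
  have "\<eta> i (Zvec br \<phi> \<xi>) = 0" for i
  proof -
    obtain j k where "even_triple i j k"
      using exhaust_3[of i] by (auto simp: even_triple_def)
    then show ?thesis by (simp add: Zvec_eq[symmetric] eta_phi_aux)
  qed
  then show ?thesis by (simp add: horizontal_def)
qed

lemma psi_eq:
  assumes X: "X \<in> horizontal \<eta>"
  shows "br (\<xi> i) (\<phi> i X) = psi br \<phi> \<xi> X" "\<phi> i (br (\<xi> i) X) = psi br \<phi> \<xi> X"
proof -
  have h: "\<eta> l X = 0" for l using X by (auto simp: horizontal_def)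
  have rot: "br (\<xi> i) (\<phi> i X) = br (\<xi> k) (\<phi> k X)" if e: "even_triple i j k" for i j k
  proof -
    have e': "even_triple j k i" using even_triple_rotate[OF e] .
    have "\<eta> j (\<xi> k) = 0"
      using structure_aux(6)[OF even_triple_rotate[OF e'], of "\<xi> k"]
        phi_xi_aux[of k] linear_0[OF contact_aux(4)[of i]] by simp
    moreover have "\<eta> j (\<phi> k X) = 0" using structure_aux(5)[OF e'] h by simp
    ultimately have "br (\<phi> j (\<xi> k)) (\<phi> j (\<phi> k X)) = br (\<xi> k) (\<phi> k X)"
      by (rule abelian_aux(2))
    moreover have "\<phi> j (\<xi> k) = \<xi> i" using structure_aux(3)[OF e'] .
    moreover have "\<phi> j (\<phi> k X) = \<phi> i X" using structure_aux(1)[OF e', of X] h by simp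
    ultimately show ?thesis by simp
  qed
  show "br (\<xi> i) (\<phi> i X) = psi br \<phi> \<xi> X"
    using rot[of 1 2 3] rot[of 3 1 2] exhaust_3[of i]
    by (auto simp: psi_def even_triple_def)
  then show "\<phi> i (br (\<xi> i) X) = psi br \<phi> \<xi> X" by (simp add: abelian_aux(1))
qed

lemma psi_horizontal:
  assumes "X \<in> horizontal \<eta>"
  shows "psi br \<phi> \<xi> X \<in> horizontal \<eta>"
  unfolding horizontal_def using psi_eq(2)[OF assms] eta_phi_aux
  by (metis (mono_tags, lifting) INT_I mem_Collect_eq)

end

end

theory Submission
  imports Defs
begin

text \<open>
  Vanishing of \<open>psi\<close> means that every \<open>\<xi> i\<close> commutes with the horizontal space \<open>h\<close>; by the Jacobi
  identity so do all \<open>[\<xi> i, \<xi> j] = 2\<delta> \<xi> k - \<phi> k Z\<close>, hence \<open>\<phi> k Z\<close> is central in \<open>h\<close>, and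
  \<open>[Z, X] = [\<phi> k Z, \<phi> k X] = 0\<close>. If \<open>\<delta> \<noteq> 0\<close>, the vectors \<open>e i = 2\<delta> \<xi> i - \<phi> i Z\<close> commute with \<open>h\<close>
  and satisfy \<open>[e i, e j] = 4\<delta>\<^sup>2 e k\<close>, so their span is a complement of \<open>h\<close> on which the bracket
  is a rescaled cross product.
\<close>

lemma lie_algebra_on_bilinear:
  assumes "lie_algebra_on UNIV br"
  shows "bilinear br"
  using assms by (auto simp: lie_algebra_on_def bilinear_def intro!: linearI)

section \<open>The model of so(3) as \<open>real^3\<close> with the cross product\<close>

text \<open>This is the matrix of the map sending \<open>v\<close> to
  \<open>cross3 a v\<close>.\<close>

definition hat :: "real^3 \<Rightarrow> real^3^3" where
  "hat a = vector [vector [0, - a$3, a$2], vector [a$3, 0, - a$1], vector [- a$2, a$1, 0]]"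

lemma linear_hat: "linear hat"
  by (rule linearI) (simp_all add: hat_def vec_eq_iff forall_3 algebra_simps)

text \<open>Read as operators, this is the Jacobi identity a x (b x v) - b x (a x v) = (a x b) x v
  of the cross product.\<close>

lemma commutator_hat: "commutator (hat a) (hat b) = hat (cross3 a b)"
  by (simp add: commutator_def hat_def vec_eq_iff forall_3 matrix_matrix_mult_def sum_3 cross3_def
      algebra_simps)

lemma bij_betw_hat: "bij_betw hat UNIV so3"
proof -
  have "inj hat"
    by (auto simp: inj_on_def hat_def vec_eq_iff forall_3)
  moreover have "hat a \<in> so3" for a
    by (simp add: so3_def hat_def vec_eq_iff forall_3 transpose_def)
  moreover have "A \<in> range hat" if "A \<in> so3" for A
  proof
    have skew: "A$j$i = - A$i$j" for i j
    proof -
      have "A$j$i = transpose A$i$j"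
        by (simp add: transpose_def)
      also have "\<dots> = - A$i$j"
        using that by (simp add: so3_def)
      finally show ?thesis .
    qed
    have "A$i$i = 0" for i
      using skew[of i i] by linarith
    then show "A = hat (vector [A$3$2, A$1$3, A$2$1])"
      by (simp add: hat_def vec_eq_iff forall_3 skew[of 1 2] skew[of 3 1] skew[of 2 3])
  qed simp
  ultimately show ?thesis
    by (auto simp: bij_betw_def)
qed

lemma even_triple_exists:
  obtains j k where "even_triple i j k"
  using exhaust_3[of i] by (auto simp: even_triple_def)

section \<open>Contact identities and the horizontal space\<close>

context
  fixes br :: "'a::real_vector \<Rightarrow> 'a \<Rightarrow> 'a" and \<phi> :: "3 \<Rightarrow> 'a \<Rightarrow> 'a" and \<xi> :: "3 \<Rightarrow> 'a"
    and \<eta> :: "3 \<Rightarrow> 'a \<Rightarrow> real"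
  assumes A: "abelian_almost_3_contact_lie_algebra br \<phi> \<xi> \<eta>"
begin

lemma lie: "lie_algebra_on UNIV br"
  using A by (simp add: abelian_almost_3_contact_lie_algebra_def almost_3_contact_lie_algebra_def)

lemmas bilin = lie_algebra_on_bilinear[OF lie]

lemmas br_simps = bilinear_ladd[OF bilin] bilinear_radd[OF bilin] bilinear_lmul[OF bilin]
  bilinear_rmul[OF bilin] bilinear_lzero[OF bilin] bilinear_rzero[OF bilin]
  bilinear_lsub[OF bilin] bilinear_rsub[OF bilin] bilinear_lneg[OF bilin] bilinear_rneg[OF bilin]

lemma br_self: "br X X = 0"
  using lie by (simp add: lie_algebra_on_def)

lemmas br_anti = br_minus_aux(3)[OF A]

lemma jacobi: "br X (br Y W) + br Y (br W X) + br W (br X Y) = 0"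
  using lie unfolding lie_algebra_on_def by blast

lemmas eta_lin = contact_aux(4)[OF A]

lemmas eta_simps = linear_add[OF eta_lin] linear_cmul[OF eta_lin] linear_0[OF eta_lin]
  linear_diff[OF eta_lin] linear_neg[OF eta_lin]

lemmas phi_lin = contact_aux(3)[OF A]

text \<open>Up to sign, \<open>\<xi> k\<close> is a value of both \<open>\<phi> i\<close> and
  \<open>\<phi> j\<close>, and \<open>\<eta> i\<close> kills the image of
  \<open>\<phi> i\<close>.\<close>

lemma eta_xi: "\<eta> i (\<xi> j) = (if i = j then 1 else 0)"
proof -
  have "\<eta> i (\<xi> k) = 0 \<and> \<eta> j (\<xi> k) = 0" if e: "even_triple i j k" for i j k
    using structure_aux(3,4)[OF A e] eta_phi_aux[OF A, of i "\<xi> j"] eta_phi_aux[OF A, of j "\<xi> i"]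
    by (simp add: eta_simps)
  from this[of 1 2 3] this[of 2 3 1] this[of 3 1 2] show ?thesis
    using exhaust_3[of i] exhaust_3[of j] contact_aux(2)[OF A]
    by (auto simp: even_triple_def)
qed

lemma horizontal_iff: "X \<in> horizontal \<eta> \<longleftrightarrow> (\<forall>i. \<eta> i X = 0)"
  by (auto simp: horizontal_def)

lemma subspace_horizontal: "subspace (horizontal \<eta>)"
  by (auto simp: subspace_def horizontal_iff eta_simps)

text \<open>Composing any \<open>\<eta> l\<close> with \<open>\<phi> i\<close> gives zero or, up to
  sign, another of the three forms.\<close>

lemma phi_horizontal:
  assumes "X \<in> horizontal \<eta>"
  shows "\<phi> i X \<in> horizontal \<eta>"
proof -
  obtain j k where e: "even_triple i j k" by (rule even_triple_exists)
  have e': "even_triple k i j"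
    using e by (auto simp: even_triple_def)
  have "\<eta> i (\<phi> i X) = 0" "\<eta> j (\<phi> i X) = 0" "\<eta> k (\<phi> i X) = 0"
    using assms eta_phi_aux[OF A] structure_aux(6)[OF A e] structure_aux(5)[OF A e']
    by (simp_all add: horizontal_iff)
  moreover have "l = i \<or> l = j \<or> l = k" for l
    using e exhaust_3[of l] by (auto simp: even_triple_def)
  ultimately show ?thesis
    by (metis horizontal_iff)
qed

lemma phi_phi_horizontal: "X \<in> horizontal \<eta> \<Longrightarrow> \<phi> i (\<phi> i X) = - X"
  by (simp add: contact_aux(1)[OF A] horizontal_iff)

text \<open>On horizontal vectors the correction terms with \<open>\<eta>\<close> vanish, so the
  contact identities become the quaternion relations.\<close>

lemma abelian_hypercomplex_horizontal: "abelian_hypercomplex (horizontal \<eta>) br \<phi>"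
proof -
  have "even_triple 1 2 3" by (simp add: even_triple_def)
  note s = structure_aux(1,2)[OF A this]
  have "\<phi> 1 (\<phi> 2 X) = \<phi> 3 X \<and> - \<phi> 2 (\<phi> 1 X) = \<phi> 3 X" if "X \<in> horizontal \<eta>" for X
    using s[of X] that by (simp add: horizontal_iff)
  moreover have "br (\<phi> i X) (\<phi> i Y) = br X Y" if "X \<in> horizontal \<eta>" "Y \<in> horizontal \<eta>" for i X Y
    using abelian_aux(2)[OF A, of i X Y] that by (simp add: horizontal_iff)
  ultimately show ?thesis
    using phi_horizontal phi_phi_horizontal
    by (auto simp: abelian_hypercomplex_def linear_add[OF phi_lin] linear_cmul[OF phi_lin])
qed

text \<open>Since Z is \<open>\<phi> k\<close> of this bracket, applying \<open>\<phi> k\<close>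
  once more recovers the bracket up to sign and its \<open>\<xi> k\<close> component.\<close>

lemma bracket_xi:
  assumes e: "even_triple i j k"
  shows "br (\<xi> i) (\<xi> j) = (2 * delta br \<xi> \<eta>) *\<^sub>R \<xi> k - \<phi> k (Zvec br \<phi> \<xi>)"
proof -
  have e': "even_triple k i j"
    using e by (auto simp: even_triple_def)
  have "\<phi> k (Zvec br \<phi> \<xi>) = - br (\<xi> i) (\<xi> j) + \<eta> k (br (\<xi> i) (\<xi> j)) *\<^sub>R \<xi> k"
    by (simp add: Zvec_eq[OF A e', symmetric] contact_aux(1)[OF A])
  then show ?thesis
    by (simp add: delta_eq[OF A e'])
qed

section \<open>Adjoint action and central vectors when psi vanishes\<close>

context
  assumes psi0: "\<forall>X\<in>horizontal \<eta>. psi br \<phi> \<xi> X = 0"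
begin

text \<open>Up to sign \<open>X\<close> is \<open>\<phi> i (\<phi> i X)\<close>, so the bracket is,
  up to sign, psi evaluated at \<open>\<phi> i X\<close>.\<close>

lemma bracket_xi_horizontal:
  assumes "X \<in> horizontal \<eta>"
  shows "br (\<xi> i) X = 0"
proof -
  have "br (\<xi> i) (\<phi> i (\<phi> i X)) = 0"
    using psi_eq(1)[OF A phi_horizontal[OF assms]] psi0 phi_horizontal[OF assms] by simp
  then show ?thesis
    by (simp add: phi_phi_horizontal[OF assms] br_simps)
qed

lemma phi_Z_central:
  assumes X: "X \<in> horizontal \<eta>"
  shows "br (\<phi> i (Zvec br \<phi> \<xi>)) X = 0"
proof -
  obtain j k where e: "even_triple i j k" by (rule even_triple_exists)
  have e': "even_triple j k i"
    using e by (auto simp: even_triple_def)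
  have "br X (br (\<xi> j) (\<xi> k)) = 0"
    using jacobi[of X "\<xi> j" "\<xi> k"] br_anti[of X] bracket_xi_horizontal[OF X]
    by (simp add: br_simps)
  then show ?thesis
    using br_anti[of X] bracket_xi_horizontal[OF X] by (simp add: bracket_xi[OF e'] br_simps)
qed

lemma Z_central:
  assumes X: "X \<in> horizontal \<eta>"
  shows "br (Zvec br \<phi> \<xi>) X = 0"
proof -
  have "br (Zvec br \<phi> \<xi>) X = br (\<phi> 1 (Zvec br \<phi> \<xi>)) (\<phi> 1 X)"
    using abelian_aux(2)[OF A, of 1] X Zvec_horizontal[OF A] by (simp add: horizontal_iff)
  then show ?thesis
    by (simp add: phi_Z_central[OF phi_horizontal[OF X]])
qed

section \<open>The horizontal space is an ideal when Z is nonzero\<close>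

context
  assumes Z0: "Zvec br \<phi> \<xi> \<noteq> 0"
begin

text \<open>On the span of \<open>\<phi> j Z\<close> and \<open>\<phi> k Z\<close> the map
  \<open>\<phi> i\<close> squares to -1. Applying it to the relation gives a second one, and
  together they force \<open>a * a + b * b = 0\<close>.\<close>

lemma phi_Z_independent:
  assumes e: "even_triple i j k" and eq: "a *\<^sub>R \<phi> k (Zvec br \<phi> \<xi>) = b *\<^sub>R \<phi> j (Zvec br \<phi> \<xi>)"
  shows "a = 0"
proof -
  let ?Z = "Zvec br \<phi> \<xi>"
  note Zh = Zvec_horizontal[OF A]
  have k: "\<phi> k ?Z = \<phi> i (\<phi> j ?Z)"
    using structure_aux(1)[OF A e, of ?Z] Zh by (simp add: horizontal_iff)
  have "\<phi> i (a *\<^sub>R \<phi> k ?Z) = \<phi> i (b *\<^sub>R \<phi> j ?Z)"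
    using eq by simp
  then have 1: "- (a *\<^sub>R \<phi> j ?Z) = b *\<^sub>R \<phi> k ?Z"
    using phi_phi_horizontal[OF phi_horizontal[OF Zh]]
    by (simp add: linear_cmul[OF phi_lin] k)
  have "(a * a) *\<^sub>R \<phi> j ?Z = - (b *\<^sub>R (a *\<^sub>R \<phi> k ?Z))"
    using arg_cong[OF 1, of "\<lambda>x. - (a *\<^sub>R x)"] by (simp add: mult.commute)
  also have "\<dots> = - ((b * b) *\<^sub>R \<phi> j ?Z)"
    by (simp add: eq)
  finally have "(a * a + b * b) *\<^sub>R \<phi> j ?Z = 0"
    by (simp add: scaleR_add_left)
  moreover have "\<phi> j ?Z \<noteq> 0"
    using phi_phi_horizontal[OF Zh, of j] Z0 linear_0[OF phi_lin, of j] by force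
  ultimately show ?thesis
    by (metis scaleR_eq_0_iff sum_squares_eq_zero_iff)
qed

lemma xi_decomposition:
  "X - (\<Sum>i\<in>UNIV. \<eta> i X *\<^sub>R \<xi> i) \<in> horizontal \<eta>"
  by (simp add: horizontal_iff eta_simps sum_3 eta_xi forall_3)

text \<open>The bracket of two horizontal vectors commutes with every \<open>\<xi> i\<close> by the Jacobi identity,
  and the linear independence of the \<open>\<phi> i Z\<close> forces its vertical part to vanish.\<close>

lemma bracket_horizontal:
  assumes X: "X \<in> horizontal \<eta>" and Y: "Y \<in> horizontal \<eta>"
  shows "br X Y \<in> horizontal \<eta>"
proof -
  have "\<eta> j (br X Y) = 0" for j
  proof -
    obtain k i where e0: "even_triple j k i" by (rule even_triple_exists)
    have e: "even_triple i j k" and e': "even_triple k i j"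
      using e0 by (auto simp: even_triple_def)
    let ?W = "br X Y" and ?Z = "Zvec br \<phi> \<xi>"
    define H where "H = ?W - (\<Sum>l\<in>UNIV. \<eta> l ?W *\<^sub>R \<xi> l)"
    have H: "H \<in> horizontal \<eta>"
      unfolding H_def by (rule xi_decomposition)
    have W: "?W = H + (\<eta> i ?W *\<^sub>R \<xi> i + \<eta> j ?W *\<^sub>R \<xi> j + \<eta> k ?W *\<^sub>R \<xi> k)"
      using e by (auto simp: H_def sum_3 even_triple_def)
    have "br (\<xi> i) ?W = 0"
      using jacobi[of X Y "\<xi> i"] br_anti[of Y "\<xi> i"] br_anti[of X "\<xi> i"]
        bracket_xi_horizontal[OF X] bracket_xi_horizontal[OF Y] by (simp add: br_simps)
    \<comment> \<open>Expanding \<open>?W\<close> by \<open>W\<close>, the horizontal part and the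
      \<open>\<xi> i\<close> term commute with \<open>\<xi> i\<close>; two vertical terms
      survive.\<close>
    then have "\<eta> j ?W *\<^sub>R br (\<xi> i) (\<xi> j) - \<eta> k ?W *\<^sub>R br (\<xi> k) (\<xi> i) = 0"
      by (subst (asm) W)
        (simp add: br_simps bracket_xi_horizontal[OF H] br_self br_anti[of "\<xi> i" "\<xi> k"])
    then have eq: "\<eta> j ?W *\<^sub>R ((2 * delta br \<xi> \<eta>) *\<^sub>R \<xi> k - \<phi> k ?Z)
        = \<eta> k ?W *\<^sub>R ((2 * delta br \<xi> \<eta>) *\<^sub>R \<xi> j - \<phi> j ?Z)"
      by (simp add: bracket_xi[OF e] bracket_xi[OF e'])
    have Zh: "\<eta> l (\<phi> m ?Z) = 0" for l m
      using phi_horizontal[OF Zvec_horizontal[OF A]] by (simp add: horizontal_iff)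
    have jk: "j \<noteq> k"
      using e by (auto simp: even_triple_def)
    \<comment> \<open>These are the vertical components of \<open>eq\<close>. Either delta is zero
      and \<open>eq\<close> is already a relation between the \<open>\<phi>\<close> images of Z, or
      both coefficients vanish.\<close>
    have d: "\<eta> j ?W * delta br \<xi> \<eta> = 0" "\<eta> k ?W * delta br \<xi> \<eta> = 0"
      using arg_cong[OF eq, of "\<eta> k"] arg_cong[OF eq, of "\<eta> j"] jk
      by (auto simp: eta_simps eta_xi Zh)
    have "\<eta> j ?W *\<^sub>R \<phi> k ?Z = \<eta> k ?W *\<^sub>R \<phi> j ?Z"
    proof (cases "delta br \<xi> \<eta> = 0")
      case True
      then show ?thesis using eq by simp
    next
      case False
      then show ?thesis using d by simp
    qed
    then show ?thesis
      by (rule phi_Z_independent[OF e])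
  qed
  then show ?thesis by (simp add: horizontal_iff)
qed

text \<open>The vertical part of \<open>X\<close> acts trivially on \<open>Y\<close>, which leaves a
  bracket of two horizontal vectors.\<close>

lemma lie_ideal_horizontal: "lie_ideal UNIV br (horizontal \<eta>)"
proof -
  have "br X Y \<in> horizontal \<eta>" if Y: "Y \<in> horizontal \<eta>" for X Y
  proof -
    define H where "H = X - (\<Sum>l\<in>UNIV. \<eta> l X *\<^sub>R \<xi> l)"
    have H: "H \<in> horizontal \<eta>"
      unfolding H_def by (rule xi_decomposition)
    have X: "X = H + (\<Sum>l\<in>UNIV. \<eta> l X *\<^sub>R \<xi> l)"
      by (simp add: H_def)
    have "br X Y = br H Y"
      by (subst X) (simp add: br_simps sum_3 bracket_xi_horizontal[OF Y])
    then show ?thesis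
      using bracket_horizontal[OF H Y] by simp
  qed
  then show ?thesis
    by (simp add: lie_ideal_def subspace_horizontal)
qed

section \<open>The frame of u and its brackets\<close>

text \<open>By \<open>bracket_xi\<close> this is \<open>br (\<xi> j) (\<xi> k)\<close> for an even
  triple \<open>i j k\<close>.\<close>

definition frame :: "3 \<Rightarrow> 'a" where
  "frame i = (2 * delta br \<xi> \<eta>) *\<^sub>R \<xi> i - \<phi> i (Zvec br \<phi> \<xi>)"

text \<open>Parametrizing u by \<open>real^3\<close> lets its bracket be written with
  \<open>cross3\<close>.\<close>

definition comb :: "real^3 \<Rightarrow> 'a" where
  "comb a = (\<Sum>i\<in>UNIV. a$i *\<^sub>R frame i)"

lemma linear_comb: "linear comb"
  by (rule linearI) (simp_all add: comb_def scaleR_add_left sum.distrib scaleR_sum_right)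

lemma eta_comb: "\<eta> i (comb a) = 2 * delta br \<xi> \<eta> * a$i"
proof -
  have Zh: "\<eta> l (\<phi> m (Zvec br \<phi> \<xi>)) = 0" for l m
    using phi_horizontal[OF Zvec_horizontal[OF A]] by (simp add: horizontal_iff)
  show ?thesis
    using exhaust_3[of i] by (auto simp: comb_def frame_def sum_3 eta_simps Zh eta_xi)
qed

lemma bracket_comb_horizontal:
  assumes "X \<in> horizontal \<eta>"
  shows "br (comb a) X = 0"
  by (simp add: comb_def frame_def sum_3 br_simps bracket_xi_horizontal[OF assms]
      phi_Z_central[OF assms])

text \<open>The \<open>\<phi>\<close> images of Z commute with each other and with every
  \<open>\<xi>\<close>, so only the brackets of the \<open>\<xi>\<close> parts, each scaled by 2
  delta, remain.\<close>

lemma bracket_frame: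
  assumes e: "even_triple i j k"
  shows "br (frame i) (frame j) = (4 * (delta br \<xi> \<eta>)\<^sup>2) *\<^sub>R frame k"
proof -
  note Zh = phi_horizontal[OF Zvec_horizontal[OF A]]
  have "br (frame i) (frame j) = (4 * (delta br \<xi> \<eta>)\<^sup>2) *\<^sub>R br (\<xi> i) (\<xi> j)"
    using br_anti[of _ "\<xi> j"]
    by (simp add: frame_def br_simps phi_Z_central[OF Zh] bracket_xi_horizontal[OF Zh]
        power2_eq_square)
  then show ?thesis
    by (simp add: bracket_xi[OF e] frame_def)
qed

lemma bracket_comb: "br (comb a) (comb b) = (4 * (delta br \<xi> \<eta>)\<^sup>2) *\<^sub>R comb (cross3 a b)"
proof -
  have *: "br (frame 1) (frame 2) = (4 * (delta br \<xi> \<eta>)\<^sup>2) *\<^sub>R frame 3"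
    "br (frame 2) (frame 3) = (4 * (delta br \<xi> \<eta>)\<^sup>2) *\<^sub>R frame 1"
    "br (frame 3) (frame 1) = (4 * (delta br \<xi> \<eta>)\<^sup>2) *\<^sub>R frame 2"
    by (rule bracket_frame; simp add: even_triple_def)+
  show ?thesis
    by (simp add: comb_def sum_3 br_simps br_self * br_anti[of "frame 2" "frame 1"]
        br_anti[of "frame 3" "frame 2"] br_anti[of "frame 1" "frame 3"] cross3_def algebra_simps)
qed

lemma range_comb: "range comb = span {frame 1, frame 2, frame 3}"
proof
  show "range comb \<subseteq> span {frame 1, frame 2, frame 3}"
    by (auto simp: comb_def sum_3 intro!: span_add span_scale intro: span_base)
  have "frame i = comb (axis i 1)" for i
    using exhaust_3[of i] by (auto simp: comb_def sum_3 axis_def)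
  then have "{frame 1, frame 2, frame 3} \<subseteq> range comb"
    by auto
  moreover have "subspace (range comb)"
    by (rule linear_subspace_image[OF linear_comb subspace_UNIV])
  ultimately show "span {frame 1, frame 2, frame 3} \<subseteq> range comb"
    by (rule span_minimal)
qed

section \<open>The splitting of the algebra for nonzero delta\<close>

context
  assumes d0: "delta br \<xi> \<eta> \<noteq> 0"
begin

text \<open>The vertical part of \<open>frame i\<close> is 2 delta times \<open>\<xi> i\<close>;
  dividing by this factor makes \<open>coord\<close> a left inverse of \<open>comb\<close>, with
  kernel h.\<close>

definition coord :: "'a \<Rightarrow> real^3" where
  "coord X = (\<chi> i. \<eta> i X / (2 * delta br \<xi> \<eta>))"

lemma linear_coord: "linear coord"
  by (rule linearI) (simp_all add: coord_def vec_eq_iff eta_simps add_divide_distrib)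

lemma coord_comb: "coord (comb a) = a"
  using d0 by (simp add: coord_def eta_comb vec_eq_iff)

lemma coord_horizontal: "coord X = 0 \<longleftrightarrow> X \<in> horizontal \<eta>"
  using d0 by (simp add: coord_def vec_eq_iff horizontal_iff)

lemma frame_decomposition: "X - comb (coord X) \<in> horizontal \<eta>"
  by (simp add: coord_horizontal[symmetric] linear_diff[OF linear_coord] coord_comb)

lemma bracket_comb_right: "br X (comb b) = br (comb (coord X)) (comb b)"
proof -
  have "br (X - comb (coord X)) (comb b) = 0"
    using bracket_comb_horizontal[OF frame_decomposition] br_anti by (metis neg_equal_0_iff_equal)
  then show ?thesis by (simp add: br_simps)
qed

lemma lie_ideal_range_comb: "lie_ideal UNIV br (range comb)"
proof -
  have "br X (comb b) \<in> range comb" for X b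
    unfolding bracket_comb_right[of X] bracket_comb
    by (simp flip: linear_cmul[OF linear_comb])
  then show ?thesis
    by (auto simp: lie_ideal_def intro: linear_subspace_image[OF linear_comb subspace_UNIV])
qed

text \<open>The mixed terms vanish because u commutes with h.\<close>

lemma bracket_decomposition:
  "br X Y = br (comb (coord X)) (comb (coord Y)) + br (X - comb (coord X)) (Y - comb (coord Y))"
  using bracket_comb_right[of X] bracket_comb_horizontal[OF frame_decomposition[of Y]]
  by (simp add: br_simps)

lemma coord_bracket: "coord (br X Y) = (4 * (delta br \<xi> \<eta>)\<^sup>2) *\<^sub>R cross3 (coord X) (coord Y)"
proof -
  \<comment> \<open>The horizontal part contributes no coordinates, since h is closed under the
    bracket.\<close>
  have "coord (br (X - comb (coord X)) (Y - comb (coord Y))) = 0"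
    unfolding coord_horizontal by (intro bracket_horizontal frame_decomposition)
  then show ?thesis
    by (subst bracket_decomposition)
      (simp add: linear_add[OF linear_coord] bracket_comb linear_cmul[OF linear_coord] coord_comb)
qed

text \<open>The map splits a vector into its u and h components; addition inverts it.\<close>

lemma lie_isomorphic_product:
  "lie_isomorphic UNIV br (range comb \<times> horizontal \<eta>) (prod_bracket br br)"
proof -
  define f where "f X = (comb (coord X), X - comb (coord X))" for X
  have "bij_betw f UNIV (range comb \<times> horizontal \<eta>)"
  proof (rule bij_betw_byWitness[where f' = "\<lambda>(x, y). x + y"])
    show "f ` UNIV \<subseteq> range comb \<times> horizontal \<eta>"
      by (auto simp: f_def frame_decomposition)
    have "coord (comb a + Y) = a" if "Y \<in> horizontal \<eta>" for a Y
      using that by (simp add: linear_add[OF linear_coord] coord_comb flip: coord_horizontal)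
    then show "\<forall>p\<in>range comb \<times> horizontal \<eta>. f (case p of (x, y) \<Rightarrow> x + y) = p"
      by (auto simp: f_def)
  qed (auto simp: f_def)
  moreover have "f (X + Y) = f X + f Y" "f (c *\<^sub>R X) = c *\<^sub>R f X" for X Y c
    by (simp_all add: f_def linear_add[OF linear_coord] linear_add[OF linear_comb]
        linear_cmul[OF linear_coord] linear_cmul[OF linear_comb] scaleR_diff_right)
  moreover have "f (br X Y) = prod_bracket br br (f X) (f Y)" for X Y
  proof -
    have "comb (coord (br X Y)) = br (comb (coord X)) (comb (coord Y))"
      by (simp add: coord_bracket bracket_comb linear_cmul[OF linear_comb])
    moreover from this have
      "br X Y - comb (coord (br X Y)) = br (X - comb (coord X)) (Y - comb (coord Y))"
      using bracket_decomposition[of X Y] by (metis add_diff_cancel_left')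
    ultimately show ?thesis
      by (simp add: f_def prod_bracket_def)
  qed
  ultimately show ?thesis
    unfolding lie_isomorphic_def by blast
qed

text \<open>In coordinates the bracket of u is \<open>?c\<close> times the cross product. Rescaling
  by \<open>?c\<close> absorbs the factor, as (ca) x (cb) = c (c (a x b)), and \<open>hat\<close>
  then leads to matrices.\<close>

lemma lie_isomorphic_so3: "lie_isomorphic (range comb) br so3 commutator"
proof -
  let ?c = "4 * (delta br \<xi> \<eta>)\<^sup>2"
  define f where "f X = hat (?c *\<^sub>R coord X)" for X
  have c: "?c \<noteq> 0" using d0 by simp
  have "bij_betw coord (range comb) UNIV"
    by (rule bij_betw_byWitness[where f' = comb]) (auto simp: coord_comb)
  moreover have "bij_betw (\<lambda>a. ?c *\<^sub>R a) UNIV (UNIV :: (real^3) set)"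
    by (rule bij_betw_byWitness[where f' = "\<lambda>a. inverse ?c *\<^sub>R a"]) (use c in auto)
  ultimately have "bij_betw (hat \<circ> ((\<lambda>a. ?c *\<^sub>R a) \<circ> coord)) (range comb) so3"
    using bij_betw_hat by (intro bij_betw_trans)
  then have "bij_betw f (range comb) so3"
    by (simp add: f_def[abs_def] comp_def)
  moreover have "f (X + Y) = f X + f Y" "f (b *\<^sub>R X) = b *\<^sub>R f X" for X Y b
    by (simp_all add: f_def linear_add[OF linear_coord] linear_cmul[OF linear_coord]
        scaleR_add_right linear_add[OF linear_hat] linear_cmul[OF linear_hat] mult_ac)
  moreover have "f (br X Y) = commutator (f X) (f Y)" for X Y
    by (simp add: f_def commutator_hat coord_bracket cross_mult_left cross_mult_right)
  ultimately show ?thesis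
    unfolding lie_isomorphic_def by blast
qed

end

end

end

end


theorem proposition5p3:
  fixes br :: "'a::real_vector \<Rightarrow> 'a \<Rightarrow> 'a"
    and \<phi> :: "3 \<Rightarrow> 'a \<Rightarrow> 'a" and \<xi> :: "3 \<Rightarrow> 'a" and \<eta> :: "3 \<Rightarrow> 'a \<Rightarrow> real"
  defines "h \<equiv> horizontal \<eta>"
    and "Z \<equiv> Zvec br \<phi> \<xi>"
    and "\<delta> \<equiv> delta br \<xi> \<eta>"
  defines "u \<equiv> span {(2 * \<delta>) *\<^sub>R \<xi> 1 - \<phi> 1 Z, (2 * \<delta>) *\<^sub>R \<xi> 2 - \<phi> 2 Z, (2 * \<delta>) *\<^sub>R \<xi> 3 - \<phi> 3 Z}"
  assumes "abelian_almost_3_contact_lie_algebra br \<phi> \<xi> \<eta>"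
    and "\<forall>X\<in>h. psi br \<phi> \<xi> X = 0"
    and "Z \<noteq> 0"
  shows "lie_ideal UNIV br h \<and> abelian_hypercomplex h br \<phi>
    \<and> Z \<in> lie_center h br \<and> (\<forall>i. \<phi> i Z \<in> lie_center h br)
    \<and> (\<forall>i j k. even_triple i j k \<longrightarrow> br (\<xi> i) (\<xi> j) = (2 * \<delta>) *\<^sub>R \<xi> k - \<phi> k Z)
    \<and> (\<forall>i. \<forall>X\<in>h. br (\<xi> i) X = 0)
    \<and> (\<delta> \<noteq> 0 \<longrightarrow>
         lie_isomorphic UNIV br (u \<times> h) (prod_bracket br br)
         \<and> lie_ideal UNIV br u
         \<and> lie_isomorphic u br so3 commutator)"
proof -
  note A = assms(5) and psi0 = assms(6)[unfolded h_def] and Z0 = assms(7)[unfolded Z_def]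
  have Zh: "Z \<in> h"
    unfolding Z_def h_def by (rule Zvec_horizontal[OF A])
  have "Z \<in> lie_center h br" "\<phi> i Z \<in> lie_center h br" for i
    using Zh phi_horizontal[OF A] phi_Z_central[OF A psi0] Z_central[OF A psi0]
    by (auto simp: lie_center_def Z_def h_def)
  \<comment> \<open>The results on u are stated for the range of \<open>comb\<close>, so the span is
    first put in that form.\<close>
  moreover have "u = range (comb br \<phi> \<xi> \<eta>)"
    by (simp add: u_def range_comb[OF A psi0 Z0] frame_def[OF A psi0 Z0] Z_def \<delta>_def)
  ultimately show ?thesis
    using lie_ideal_horizontal[OF A psi0 Z0] abelian_hypercomplex_horizontal[OF A]
      bracket_xi[OF A] bracket_xi_horizontal[OF A psi0] lie_isomorphic_product[OF A psi0 Z0]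
      lie_ideal_range_comb[OF A psi0 Z0] lie_isomorphic_so3[OF A psi0 Z0]
    unfolding h_def Z_def \<delta>_def by blast
qed

end
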